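(* Let $d \geq 2$ be a fixed integer. There is a constant $c = c(d) > 0$ such that for every positive integer $n$ there is a subset $A \subset [n]^d$ with $|A| \geq c n$ such that no $d+1$ points of $A$ lie on a common hyperplane and no $2d$ points of $A$ lie on a common sphere.
   Context: $[n]=\{1,\dots,n\}$. A sphere means a $(d-1)$-dimensional sphere in $\mathbb{R}^d$; a hyperplane means an affine hyperplane in $\mathbb{R}^d$. *)

theory Defs
  imports "HOL-Analysis.Analysis"
begin

definition grid :: "nat \<Rightarrow> (real ^ 'd) set" where
  "grid n = {x. \<forall>i. \<exists>k::nat. k \<in> {1..n} \<and> x $ i = real k}"

definition is_hyperplane :: "(real ^ 'd) set \<Rightarrow> bool" where
  "is_hyperplane H \<longleftrightarrow> (\<exists>a b. a \<noteq> 0 \<and> H = {x. a \<bullet> x = b})"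

definition is_sphere :: "(real ^ 'd) set \<Rightarrow> bool" where
  "is_sphere S \<longleftrightarrow> (\<exists>c r. r > 0 \<and> S = sphere c r)"

end

theory Submission
  imports Defs "HOL-Computational_Algebra.Primes" "HOL-Computational_Algebra.Polynomial"
begin

text \<open>
  Take the moment curve \<open>t \<mapsto> (t, t\<^sup>2, \<dots>, t\<^sup>d)\<close> reduced modulo a prime p comparable to n, for
  \<open>0 < t < p / (2d)\<close>. The linear system expressing that some of these points lie on a hyperplane
  or a sphere has integer coefficients, so a real solution yields an integer one that is nonzero
  mod p. It gives a nonzero polynomial mod p that vanishes at all the parameters t: of degree at
  most d for a hyperplane, which excludes d + 1 points; for a sphere it has the form
  \<open>\<alpha> (t\<^sup>2 + t\<^sup>4 + \<dots> + t\<^bsup>2d\<^esup>)\<close> plus terms of degree at most d, without a term of degree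
  \<open>2d - 1\<close>, so 2d roots would sum to 0 mod p, whereas their sum lies strictly between 0 and p.
  The prime comes from comparing \<open>2\<^bsup>x-1\<^esup> \<le> lcm(1, \<dots>, x)\<close> with the upper bound
  that holds if no prime lies in \<open>(x/8, x]\<close>.
\<close>

section \<open>A prime within a constant factor\<close>

text \<open>Recurrence of the Leibniz harmonic triangle, whose entries are 1 / ((n+1) * (n choose
  k)). It is solved for the entry in column \<open>Suc k\<close>, which suits an induction on the
  column.\<close>

lemma leibniz_triangle:
  assumes "k \<le> n"
  shows "1 / (real (Suc (Suc n)) * real (Suc n choose Suc k)) =
    1 / (real (Suc n) * real (n choose k)) - 1 / (real (Suc (Suc n)) * real (Suc n choose k))"
proof -
  have 1: "real (Suc k) * real (Suc n choose Suc k) = real (Suc n) * real (n choose k)"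
    by (metis Suc_times_binomial of_nat_mult)
  have 2: "(real (Suc n) - real k) * real (Suc n choose k) = real (Suc n) * real (n choose k)"
  proof -
    have "(Suc n - k) * (Suc n choose k) = Suc n * (n choose k)"
      by (metis assms binomial_absorb_comp diff_Suc_1 )
    then show ?thesis using assms by (metis of_nat_diff of_nat_mult le_SucI)
  qed
  have pos: "real (n choose k) > 0" "real (Suc n choose k) > 0" "real (Suc n choose Suc k) > 0"
    using assms by (simp_all del: binomial_Suc_Suc)
  have a: "real (Suc n choose Suc k) = real (Suc n) * real (n choose k) / real (Suc k)"
    using 1 by (simp add: field_simps del: binomial_Suc_Suc)
  have b: "real (Suc n choose k) = real (Suc n) * real (n choose k) / (real (Suc n) - real k)"
    using 2 assms by (simp add: field_simps del: binomial_Suc_Suc)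
  have nz: "real (Suc n) - real k \<noteq> 0" using assms by simp
  show ?thesis
    unfolding a b using pos(1) nz by (simp add: divide_simps)
qed

text \<open>Column 0 has the entries 1/(n+1), which \<open>D\<close> clears; by the recurrence,
  every later column consists of differences of entries of the previous one.\<close>

lemma div_Leibniz_in_Ints:
  assumes "k \<le> n" and "\<And>i. i \<in> {1..Suc n} \<Longrightarrow> i dvd D"
  shows "real D / (real (Suc n) * real (n choose k)) \<in> \<int>"
  using assms
proof (induction k arbitrary: n)
  case 0
  then have "Suc n dvd D" by simp
  then obtain q where "D = Suc n * q" by (elim dvdE)
  then have "real D / (real (Suc n) * real (n choose 0)) = real q"
    by (simp del: of_nat_Suc mult_Suc)
  then show ?case by simp
next
  case (Suc k)
  then obtain m where m: "n = Suc m" "k \<le> m" by (cases n) auto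
  have "real D / (real (Suc m) * real (m choose k)) \<in> \<int>"
    "real D / (real (Suc (Suc m)) * real (Suc m choose k)) \<in> \<int>"
    using Suc.IH[of m] Suc.IH[of "Suc m"] Suc.prems m by auto
  then have "real D / (real (Suc m) * real (m choose k)) -
      real D / (real (Suc (Suc m)) * real (Suc m choose k)) \<in> \<int>"
    by (rule Ints_diff)
  also have "real D / (real (Suc m) * real (m choose k)) -
      real D / (real (Suc (Suc m)) * real (Suc m choose k)) =
      real D * (1 / (real (Suc (Suc m)) * real (Suc m choose Suc k)))"
    by (subst leibniz_triangle[OF m(2)]) (simp only: right_diff_distrib mult_1_right times_divide_eq_right)
  finally show ?case by (simp add: m(1) del: binomial_Suc_Suc of_nat_Suc)
qed

text \<open>Each (n+1) * (n choose k) divides the lcm, hence is at most the lcm. Summing over the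
  n+1 values of k turns the binomials into 2^n, and the factor n+1 cancels.\<close>

lemma Lcm_atLeastAtMost_ge: "2 ^ n \<le> (Lcm {1..Suc n} :: nat)"
proof -
  let ?L = "Lcm {1..Suc n} :: nat"
  have L: "?L > 0" by (simp add: Lcm_0_iff_nat zero_less_iff_neq_zero)
  have "Suc n * (n choose k) \<le> ?L" if "k \<le> n" for k
  proof -
    have pos: "real (Suc n) * real (n choose k) > 0" using that by simp
    then have "real ?L / (real (Suc n) * real (n choose k)) > 0" using L by simp
    moreover have "real ?L / (real (Suc n) * real (n choose k)) \<in> \<int>"
      using that by (intro div_Leibniz_in_Ints) auto
    ultimately have "real ?L / (real (Suc n) * real (n choose k)) \<ge> 1"
      by (auto elim!: Ints_cases simp del: of_nat_Suc)
    then have "real (Suc n * (n choose k)) \<le> real ?L" using pos by (simp add: field_simps)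
    then show ?thesis by linarith
  qed
  then have "(\<Sum>k\<le>n. Suc n * (n choose k)) \<le> (\<Sum>k\<le>n. ?L)" by (intro sum_mono) auto
  then have "Suc n * 2 ^ n \<le> Suc n * ?L"
    by (simp add: sum_distrib_left[symmetric] choose_row_sum del: mult_Suc)
  then show ?thesis by (simp del: mult_Suc)
qed

section \<open>Upper bound for products of primes, and a prime below a power of 4\<close>

lemma prod_primes_dvd:
  fixes n :: nat
  assumes "finite S" "\<And>p. p \<in> S \<Longrightarrow> prime p \<and> p dvd n"
  shows "\<Prod>S dvd n"
  using assms
proof (induction S)
  case (insert p S)
  have "coprime p (\<Prod>S)"
    by (rule prod_coprime_right) (metis insert.hyps(2) insert.prems insertCI primes_coprime)
  then show ?case using insert by (simp add: divides_mult)
qed auto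

text \<open>Doubling argument: the primes in (m, 2m] all divide the central binomial coefficient,
  which is at most 4^m. Restricting to powers of 2 avoids rounding.\<close>

lemma prod_primes_le_power2: "\<Prod>{p::nat. prime p \<and> p \<le> 2 ^ k} \<le> 4 ^ 2 ^ k"
proof (induction k)
  case 0
  have "{p::nat. prime p \<and> p \<le> 2 ^ 0} = {}" by (auto dest: prime_gt_1_nat)
  then show ?case by (simp only:) simp
next
  case (Suc k)
  define m :: nat where "m = 2 ^ k"
  let ?A = "{p::nat. prime p \<and> p \<le> m}" and ?B = "{p::nat. prime p \<and> m < p \<and> p \<le> 2 * m}"
  have "p dvd (2 * m choose m)" if "p \<in> ?B" for p
  proof -
    have "fact m * fact m * (2 * m choose m) = (fact (2 * m) :: nat)"
      using binomial_fact_lemma[of m "2 * m"] by simp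
    moreover have "p dvd fact (2 * m)" "\<not> p dvd fact m"
      using that by (auto simp: prime_dvd_fact_iff)
    ultimately show ?thesis using that by (metis prime_dvd_multD mem_Collect_eq)
  qed
  then have "\<Prod>?B dvd (2 * m choose m)" by (intro prod_primes_dvd) auto
  then have "\<Prod>?B \<le> (2 * m choose m)" by (rule dvd_imp_le) simp
  also have "\<dots> \<le> (\<Sum>i\<le>2 * m. 2 * m choose i)" by (rule member_le_sum) auto
  also have "\<dots> = 4 ^ m" by (simp add: choose_row_sum power_mult)
  finally have B: "\<Prod>?B \<le> 4 ^ m" .
  have "{p::nat. prime p \<and> p \<le> 2 ^ Suc k} = ?A \<union> ?B" unfolding m_def by auto
  then have "\<Prod>{p::nat. prime p \<and> p \<le> 2 ^ Suc k} = \<Prod>?A * \<Prod>?B"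
    by (simp only:) (rule prod.union_disjoint; auto)
  also have "\<dots> \<le> 4 ^ m * 4 ^ m" using Suc B unfolding m_def by (intro mult_mono) auto
  also have "\<dots> = 4 ^ 2 ^ Suc k" by (simp add: m_def power_add[symmetric] mult_2)
  finally show ?case .
qed

text \<open>The multiplicity of p in an lcm is the maximum over the elements, so some element
  attains it. Positivity of \<open>e\<close> excludes the empty set, whose lcm is 1.\<close>

lemma prime_power_dvd_LcmE:
  fixes p :: nat
  assumes "prime p" "finite A" "0 \<notin> A" "p ^ e dvd Lcm A" "e > 0"
  obtains a where "a \<in> A" "p ^ e dvd a"
proof -
  have "\<exists>a\<in>A. p ^ e dvd a"
    using assms(2,3,4)
  proof (induction A)
    case empty
    then show ?case using assms(1,5) by (auto dest: prime_gt_1_nat)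
  next
    case (insert a A)
    then have nz: "a \<noteq> 0" "Lcm A \<noteq> 0" by (auto simp: Lcm_0_iff_nat)
    have "e \<le> multiplicity p (lcm a (Lcm A))"
      using insert.prems nz assms(1)
      by (intro multiplicity_geI) (auto simp: lcm_eq_0_iff)
    also have "\<dots> = max (multiplicity p a) (multiplicity p (Lcm A))"
      using nz assms(1) by (intro multiplicity_lcm) auto
    finally have "p ^ e dvd a \<or> p ^ e dvd Lcm A"
      by (auto simp: le_max_iff_disj multiplicity_dvd')
    then show ?case using insert by auto
  qed
  then show thesis using that by blast
qed

text \<open>Without such a prime, the prime factors of L = lcm(1, ..., x) are at most x/8. Those up
  to sqrt x contribute at most x^(sqrt x), the others occur once and contribute at most 4^(x/8), too
  little for L \<ge> 2^(x-1). For x = 4^j, both sqrt x and x/8 are powers of 2.\<close>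

lemma prime_between_power4:
  assumes "j \<ge> 4"
  shows "\<exists>p::nat. prime p \<and> 4 ^ j < 8 * p \<and> p \<le> 4 ^ j"
proof (rule ccontr)
  assume none: "\<not> ?thesis"
  define x :: nat where "x = 4 ^ j"
  define y :: nat where "y = 2 ^ j"
  have xy: "x = y * y" by (simp add: x_def y_def power_mult_distrib[symmetric])
  have x0: "x > 0" by (simp add: x_def)
  define L where "L = Lcm {1..x}"
  have L0: "L \<noteq> 0" by (auto simp: L_def Lcm_0_iff_nat)
  define P where "P = prime_factors L"
  have P: "prime p" "p ^ multiplicity p L \<le> x" "multiplicity p L > 0" if "p \<in> P" for p
  proof -
    show p: "prime p" using that by (auto simp: P_def)
    show m: "multiplicity p L > 0" using that by (simp add: P_def prime_factors_multiplicity)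
    have "p ^ multiplicity p L dvd Lcm {1..x}" unfolding L_def[symmetric] by (rule multiplicity_dvd)
    from prime_power_dvd_LcmE[OF p _ _ this m] obtain a
      where "a \<in> {1..x}" "p ^ multiplicity p L dvd a" by auto
    then show "p ^ multiplicity p L \<le> x" using dvd_imp_le[of _ a] by (meson atLeastAtMost_iff le_trans less_le_trans zero_less_one)
  qed
  have Px: "8 * p \<le> x" if "p \<in> P" for p
  proof -
    have "p \<le> p ^ multiplicity p L" using P[OF that] by (intro self_le_power) (auto dest: prime_gt_0_nat)
    then have "p \<le> x" using P(2)[OF that] by simp
    then have "\<not> x < 8 * p" using none P(1)[OF that] unfolding x_def by blast
    then show ?thesis by simp
  qed
  let ?P1 = "{p \<in> P. p \<le> y}" and ?P2 = "{p \<in> P. y < p}"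
  have finP: "finite P" by (simp add: P_def)
  have "L = (\<Prod>p\<in>P. p ^ multiplicity p L)"
    unfolding P_def using L0 by (intro prime_factorization_nat) auto
  also have "\<dots> = (\<Prod>p\<in>?P1 \<union> ?P2. p ^ multiplicity p L)" by (rule prod.cong) auto
  also have "\<dots> = (\<Prod>p\<in>?P1. p ^ multiplicity p L) * (\<Prod>p\<in>?P2. p ^ multiplicity p L)"
    using finP by (intro prod.union_disjoint) auto
  also have "\<dots> \<le> x ^ y * 4 ^ 2 ^ (2 * j - 3)"
  proof (rule mult_mono)
    have "(\<Prod>p\<in>?P1. p ^ multiplicity p L) \<le> (\<Prod>p\<in>?P1. x)" by (intro prod_mono) (auto intro: P)
    also have "\<dots> = x ^ card ?P1" by simp
    also have "\<dots> \<le> x ^ y"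
    proof (rule power_increasing)
      have "card ?P1 \<le> card {1..y}" by (intro card_mono) (auto dest!: P(1) prime_gt_0_nat)
      then show "card ?P1 \<le> y" by simp
    qed (use x0 in simp)
    finally show "(\<Prod>p\<in>?P1. p ^ multiplicity p L) \<le> x ^ y" .
    have m1: "multiplicity p L = 1" if "p \<in> ?P2" for p
    proof (rule ccontr)
      assume "multiplicity p L \<noteq> 1"
      then have "2 \<le> multiplicity p L" using P(3)[of p] that by auto
      then have "p ^ 2 \<le> p ^ multiplicity p L"
        using P(1)[of p] that by (intro power_increasing) (auto dest: prime_gt_0_nat)
      also have "\<dots> \<le> x" using P(2) that by auto
      finally have "p * p \<le> y * y" by (simp add: xy power2_eq_square)
      moreover have "y * y < p * p" using that by (intro mult_strict_mono) auto
      ultimately show False by simp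
    qed
    have x8: "x = 8 * 2 ^ (2 * j - 3)"
    proof -
      have "2 * j = 3 + (2 * j - 3)" using assms by simp
      then have "(2::nat) ^ (2 * j) = 2 ^ 3 * 2 ^ (2 * j - 3)" by (metis power_add)
      then show ?thesis by (simp add: x_def power_mult)
    qed
    have "(\<Prod>p\<in>?P2. p ^ multiplicity p L) = \<Prod>?P2" by (intro prod.cong) (auto simp: m1)
    also have "\<dots> \<le> \<Prod>{p::nat. prime p \<and> p \<le> 2 ^ (2 * j - 3)}"
    proof (rule dvd_imp_le[OF prod_dvd_prod_subset])
      show "?P2 \<subseteq> {p::nat. prime p \<and> p \<le> 2 ^ (2 * j - 3)}"
        using Px P(1) x8 by force
      show "0 < \<Prod>{p::nat. prime p \<and> p \<le> 2 ^ (2 * j - 3)}"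
        by (rule prod_pos) (auto dest: prime_gt_0_nat)
    qed auto
    also have "\<dots> \<le> 4 ^ 2 ^ (2 * j - 3)" by (rule prod_primes_le_power2)
    finally show "(\<Prod>p\<in>?P2. p ^ multiplicity p L) \<le> 4 ^ 2 ^ (2 * j - 3)" .
  qed auto
  also have "x ^ y * 4 ^ 2 ^ (2 * j - 3) = 2 ^ (2 * j * y + 2 ^ (2 * j - 2))"
  proof -
    have "2 * j - 2 = Suc (2 * j - 3)" using assms by simp
    then have "(2::nat) ^ (2 * j - 2) = 2 * 2 ^ (2 * j - 3)" by simp
    moreover have "x = 2 ^ (2 * j)" by (simp add: x_def power_mult)
    moreover have "(4::nat) ^ e = 2 ^ (2 * e)" for e by (simp add: power_mult)
    ultimately show ?thesis by (simp only: power_add power_mult[symmetric])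
  qed
  finally have "L \<le> 2 ^ (2 * j * y + 2 ^ (2 * j - 2))" .
  moreover have "2 ^ (x - 1) \<le> L"
    using Lcm_atLeastAtMost_ge[of "x - 1"] x0 by (simp add: L_def)
  ultimately have "(2::nat) ^ (x - 1) \<le> 2 ^ (2 * j * y + 2 ^ (2 * j - 2))" by linarith
  then have le: "x - 1 \<le> 2 * j * y + 2 ^ (2 * j - 2)" by (subst (asm) power_increasing_iff) auto
  have x4: "x = 4 * 2 ^ (2 * j - 2)"
  proof -
    have "2 * j = 2 + (2 * j - 2)" using assms by simp
    then have "(2::nat) ^ (2 * j) = 2 ^ 2 * 2 ^ (2 * j - 2)" by (metis power_add)
    then show ?thesis by (simp add: x_def power_mult)
  qed
  \<comment> \<open>This makes \<open>2 * j * y\<close> at most x/2, while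
    \<open>2 ^ (2 * j - 2)\<close> is x/4; so \<open>le\<close> would give x - 1 \<le> 3x/4, that is
    x \<le> 4.\<close>
  have "4 * j \<le> y" unfolding y_def using assms
    by (induction j rule: nat_induct_at_least) auto
  then have "4 * j * y \<le> x" unfolding xy by (intro mult_mono) auto
  moreover have "x \<ge> 16" unfolding x_def using power_increasing[OF assms, of "4::nat"] by simp
  ultimately show False using le x4 by linarith
qed

text \<open>Rounding n down to a power of 4 loses a factor 4, and the prime below that power another
  8. The bound 256 = 4^4 ensures j \<ge> 4.\<close>

lemma exists_prime_within_factor_32:
  assumes "n \<ge> 256"
  shows "\<exists>p::nat. prime p \<and> n < 32 * p \<and> p \<le> n"
proof -
  obtain j where j: "4 ^ j \<le> n" "n < 4 ^ Suc j"
    using ex_power_ivl1[of 4 n] assms by auto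
  have "(4::nat) ^ 4 < 4 ^ Suc j" using j(2) assms by simp
  then have "j \<ge> 4" by (subst (asm) power_strict_increasing_iff) auto
  from prime_between_power4[OF this] obtain p :: nat
    where "prime p" "4 ^ j < 8 * p" "p \<le> 4 ^ j" by blast
  then show ?thesis using j by (intro exI[of _ p]) simp
qed

section \<open>Integer polynomials modulo a prime\<close>

text \<open>Lagrange's bound on the number of roots mod p, stated over the integers to avoid
  building the field: divisibility by \<open>[:p:]\<close> means that f vanishes mod p. Splitting
  off X - r leaves a quotient that keeps the other roots, since p does not divide s - r.\<close>

lemma prime_dvd_poly_if_many_roots:
  fixes f :: "int poly"
  assumes "finite R" "prime p" "degree f < card R"
    and "\<And>r. r \<in> R \<Longrightarrow> p dvd poly f r"
    and "\<And>r s. r \<in> R \<Longrightarrow> s \<in> R \<Longrightarrow> r \<noteq> s \<Longrightarrow> \<not> p dvd r - s"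
  shows "[:p:] dvd f"
  using assms(1,3-)
proof (induction R arbitrary: f)
  case (insert r S)
  define q where "q = synthetic_div f r"
  have f: "f = [:-r, 1:] * q + [:poly f r:]"
    unfolding q_def by (simp only: synthetic_div_correct')
  have "[:p:] dvd q"
  \<comment> \<open>A constant f has quotient 0. It is separated because
    \<open>degree q < card S\<close> fails when S is empty.\<close>
  proof (cases "degree f = 0")
    case True
    then show ?thesis by (simp add: q_def synthetic_div_eq_0_iff[THEN iffD2])
  next
    case False
    show ?thesis
    proof (rule insert.IH)
      show "degree q < card S"
        using False insert.prems(1) insert.hyps by (simp add: q_def degree_synthetic_div)
      show "p dvd poly q s" if "s \<in> S" for s
      proof -
        have "poly f s = (s - r) * poly q s + poly f r"
          by (subst f) (simp add: algebra_simps)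
        then have "(s - r) * poly q s = poly f s - poly f r" by simp
        then have "p dvd (s - r) * poly q s"
          using insert.prems(2) that by (metis dvd_diff insertCI)
        moreover have "\<not> p dvd s - r" using insert.prems(3) insert.hyps that by blast
        ultimately show ?thesis using \<open>prime p\<close> by (simp add: prime_dvd_mult_iff)
      qed
    qed (use insert.prems in blast)
  qed
  moreover have "[:p:] dvd [:poly f r:]" using insert.prems(2) by (simp add: const_poly_dvd_iff coeff_pCons split: nat.splits)
  ultimately show ?case by (metis dvd_add dvd_mult f)
qed simp

lemma degree_prod_linear:
  fixes R :: "'a :: idom set"
  assumes "finite R"
  shows "degree (\<Prod>r\<in>R. [:-r, 1:]) = card R"
  using assms by (subst degree_prod_sum_eq) auto

lemma coeff_card_prod_linear:
  fixes R :: "'a :: idom set"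
  assumes "finite R"
  shows "coeff (\<Prod>r\<in>R. [:-r, 1:]) (card R) = 1"
  using lead_coeff_prod[of "\<lambda>r. [:-r, 1:]" R] degree_prod_linear[OF assms] by simp

text \<open>Vieta's formula for the second highest coefficient.\<close>

lemma coeff_pred_card_prod_linear:
  fixes R :: "'a :: idom set"
  assumes "finite R" "card R = Suc m"
  shows "coeff (\<Prod>r\<in>R. [:-r, 1:]) m = - \<Sum>R"
  using assms
proof (induction R arbitrary: m)
  case (insert r S)
  then have m: "m = card S" by simp
  show ?case
  proof (cases m)
    case 0
    then show ?thesis using insert m by simp
  next
    case (Suc k)
    then have "coeff (\<Prod>r\<in>S. [:-r, 1:]) k = - \<Sum>S" using insert.IH m by simp
    moreover have "coeff (\<Prod>r\<in>S. [:-r, 1:]) m = 1"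
      using coeff_card_prod_linear[OF insert.hyps(1)] m by simp
    ultimately show ?thesis using insert.hyps Suc by simp
  qed
qed simp

text \<open>If f is not 0 mod p, then it is a multiple of the product of the \<open>X - r\<close>, so Vieta
  makes the sum of the roots vanish mod p.\<close>
lemma prime_dvd_poly_if_sum_roots:
  fixes f :: "int poly"
  assumes "finite R" "prime p" "card R = Suc m" "degree f \<le> Suc m" "coeff f m = 0"
    and roots: "\<And>r. r \<in> R \<Longrightarrow> p dvd poly f r"
    and distinct: "\<And>r s. r \<in> R \<Longrightarrow> s \<in> R \<Longrightarrow> r \<noteq> s \<Longrightarrow> \<not> p dvd r - s"
    and sum: "\<not> p dvd \<Sum>R"
  shows "[:p:] dvd f"
proof -
  define M where "M = (\<Prod>r\<in>R. [:-r, 1:])"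
  define \<alpha> where "\<alpha> = coeff f (Suc m)"
  have M: "degree M = Suc m" "coeff M (Suc m) = 1" "coeff M m = - \<Sum>R"
    using degree_prod_linear[OF assms(1)] coeff_card_prod_linear[OF assms(1)]
      coeff_pred_card_prod_linear[OF assms(1,3)] assms(3) by (simp_all add: M_def)
  \<comment> \<open>The top coefficients cancel, so the difference has too small a degree for its
    \<open>Suc m\<close> roots and vanishes mod p. Its coefficient at \<open>m\<close> is then
    \<alpha> times the sum of the roots.\<close>
  have "degree (f - smult \<alpha> M) \<le> m"
  proof (rule degree_le, intro allI impI)
    fix i assume "m < i"
    then consider "i = Suc m" | "i > Suc m" by linarith
    then show "coeff (f - smult \<alpha> M) i = 0"
      by cases (use M assms(4) in \<open>auto simp: \<alpha>_def coeff_eq_0\<close>)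
  qed
  moreover have "poly M r = 0" if "r \<in> R" for r
    using that assms(1) by (auto simp: M_def poly_prod)
  ultimately have F: "[:p:] dvd f - smult \<alpha> M"
    using assms by (intro prime_dvd_poly_if_many_roots[of R]) auto
  then have "p dvd coeff (f - smult \<alpha> M) m" by (simp only: const_poly_dvd_iff)
  then have "p dvd \<alpha> * \<Sum>R" using M assms(5) by simp
  then have "p dvd \<alpha>" using sum \<open>prime p\<close> by (simp add: prime_dvd_mult_iff)
  then have "[:p:] dvd smult \<alpha> M" by (simp add: const_poly_dvd_iff)
  then show ?thesis using F by (metis dvd_add diff_add_cancel)
qed

section \<open>Integer solutions from real solutions\<close>

text \<open>Simultaneous Dirichlet approximation replaces rational linear algebra: with k j close to
  q * u j / u j0, the integer sum of the k j * v j differs from 0 by less than 1.\<close>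

lemma integer_relation_of_real_relation:
  fixes u :: "nat \<Rightarrow> real" and V :: "(nat \<Rightarrow> int) set"
  assumes "finite V" "j0 < n" "u j0 \<noteq> 0"
    and rel: "\<And>v. v \<in> V \<Longrightarrow> (\<Sum>j<n. u j * of_int (v j)) = 0"
  obtains k :: "nat \<Rightarrow> int" where "k j0 \<noteq> 0" "\<And>v. v \<in> V \<Longrightarrow> (\<Sum>j<n. k j * v j) = 0"
proof -
  \<comment> \<open>Larger than the sum of the absolute values of the entries of any v in V, so that
    errors below 1/N add up to less than 1.\<close>
  define N where "N = Suc (nat (\<Sum>v\<in>V. \<Sum>j<n. \<bar>v j\<bar>))"
  define \<theta> where "\<theta> j = u j / u j0" for j
  obtain q k where q: "0 < q" and k: "\<And>i. i < n \<Longrightarrow> \<bar>of_int q * \<theta> i - of_int (k i)\<bar> < 1 / real N"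
    by (rule Dirichlet_approx_simult[of N n \<theta>]) (simp add: N_def, blast)
  have N1: "1 / real N \<le> 1" by (simp add: N_def)
  show thesis
  proof
    \<comment> \<open>The normalisation gives \<open>\<theta> j0 = 1\<close>, so the integers
      \<open>k j0\<close> and \<open>q\<close> differ by less than 1.\<close>
    have "\<bar>real_of_int q - of_int (k j0)\<bar> < 1" using k[OF assms(2)] assms(3) N1 by (simp add: \<theta>_def)
    then have "k j0 = q" by linarith
    then show "k j0 \<noteq> 0" using q by simp
    fix v assume v: "v \<in> V"
    have "(\<Sum>j<n. of_int q * \<theta> j * of_int (v j)) = (of_int q / u j0) * (\<Sum>j<n. u j * of_int (v j))"
      by (simp add: sum_distrib_left \<theta>_def algebra_simps)
    also have "\<dots> = 0" using rel[OF v] by simp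
    finally have 0: "(\<Sum>j<n. of_int q * \<theta> j * of_int (v j)) = 0" .
    have "real_of_int \<bar>\<Sum>j<n. k j * v j\<bar> = \<bar>\<Sum>j<n. (of_int q * \<theta> j - of_int (k j)) * of_int (v j)\<bar>"
      using 0 by (simp add: left_diff_distrib sum_subtractf)
    also have "\<dots> \<le> (\<Sum>j<n. \<bar>(of_int q * \<theta> j - of_int (k j)) * of_int (v j)\<bar>)" by (rule sum_abs)
    also have "\<dots> \<le> (\<Sum>j<n. 1 / real N * of_int \<bar>v j\<bar>)"
      unfolding abs_mult of_int_abs by (intro sum_mono mult_right_mono less_imp_le[OF k]) auto
    also have "\<dots> = of_int (\<Sum>j<n. \<bar>v j\<bar>) / real N" by (simp add: sum_distrib_left sum_divide_distrib)
    also have "\<dots> < 1"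
    proof -
      have "(\<Sum>j<n. \<bar>v j\<bar>) \<le> (\<Sum>v\<in>V. \<Sum>j<n. \<bar>v j\<bar>)"
        using assms(1) v by (intro member_le_sum sum_nonneg) auto
      then have "(\<Sum>j<n. \<bar>v j\<bar>) < int N" by (simp add: N_def)
      then have "real_of_int (\<Sum>j<n. \<bar>v j\<bar>) < real N" by (metis of_int_less_iff of_int_of_nat_eq)
      then show ?thesis by (simp add: N_def)
    qed
    finally have "\<bar>\<Sum>j<n. k j * v j\<bar> < 1" by (simp only: of_int_less_1_iff)
    then show "(\<Sum>j<n. k j * v j) = 0" by simp
  qed
qed

text \<open>Dividing by the gcd g of the coefficients makes the relation nontrivial mod p: if p
  divided every quotient, then g * p would divide g.\<close>

lemma primitive_integer_relation_of_real_relation: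
  fixes u :: "nat \<Rightarrow> real" and V :: "(nat \<Rightarrow> int) set"
  assumes "finite V" "j0 < n" "u j0 \<noteq> 0" "prime p"
    and "\<And>v. v \<in> V \<Longrightarrow> (\<Sum>j<n. u j * of_int (v j)) = 0"
  obtains k :: "nat \<Rightarrow> int" and j1
  where "j1 < n" "\<not> p dvd k j1" "\<And>v. v \<in> V \<Longrightarrow> (\<Sum>j<n. k j * v j) = 0"
proof -
  obtain k where k: "k j0 \<noteq> 0" "\<And>v. v \<in> V \<Longrightarrow> (\<Sum>j<n. k j * v j) = 0"
    using integer_relation_of_real_relation[of V j0 n u] assms by metis
  define g where "g = Gcd (k ` {..<n})"
  have "g dvd k j0" using assms(2) by (auto simp: g_def)
  then have g0: "g \<noteq> 0" using k(1) by auto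
  have eq: "k j = g * (k j div g)" if "j < n" for j
    using that by (auto simp: g_def)
  have "\<exists>j1<n. \<not> p dvd k j1 div g"
  proof (rule ccontr)
    assume "\<not> ?thesis"
    then have "g * p dvd k j" if "j < n" for j
      using eq[OF that] that by (metis dvd_refl mult_dvd_mono)
    then have "g * p dvd g" unfolding g_def by (intro Gcd_greatest) (auto simp: g_def)
    then show False using g0 assms(4) by (auto dest: not_prime_unit)
  qed
  moreover have "(\<Sum>j<n. (k j div g) * v j) = 0" if "v \<in> V" for v
  proof -
    have "g * (\<Sum>j<n. (k j div g) * v j) = (\<Sum>j<n. k j * v j)"
      unfolding sum_distrib_left using eq by (intro sum.cong) (auto simp: mult.assoc[symmetric])
    then show ?thesis using k(2)[OF that] g0 by simp
  qed
  ultimately show thesis using that[of _ "\<lambda>j. k j div g"] by blast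
qed

section \<open>The moment curve modulo a prime\<close>

lemma not_dvd_diff_int_image:
  fixes p :: nat
  assumes "T \<subseteq> {..<p}" "r \<in> int ` T" "s \<in> int ` T" "r \<noteq> s"
  shows "\<not> int p dvd r - s"
proof
  assume "int p dvd r - s"
  then have "int p \<le> \<bar>r - s\<bar>" using dvd_imp_le_int[of "r - s" "int p"] assms(4) by simp
  moreover have "0 \<le> r" "0 \<le> s" "r < int p" "s < int p" using assms by auto
  ultimately show False by linarith
qed

text \<open>Coordinates of the points are residues; this passes from a linear form in them to a
  polynomial in the parameter t, modulo p.\<close>

lemma dvd_poly_sum_monom_diff:
  fixes k :: "nat \<Rightarrow> int"
  shows "int p dvd poly (\<Sum>j\<le>d. monom (k j) j) (int t) - (\<Sum>j\<le>d. k j * int (t ^ j mod p))"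
proof -
  have "int p dvd (\<Sum>j\<le>d. k j * (int t ^ j - int (t ^ j mod p)))"
    by (intro dvd_sum dvd_mult) (simp add: zmod_int dvd_minus_mod)
  then show ?thesis
    by (simp add: poly_sum poly_monom sum_subtractf right_diff_distrib)
qed

lemma moment_curve_mod_hyperplane:
  fixes a :: "nat \<Rightarrow> real"
  assumes "prime p" "T \<subseteq> {..<p}" "card T = Suc d" "j0 \<in> {1..d}" "a j0 \<noteq> 0"
    and "\<And>t. t \<in> T \<Longrightarrow> (\<Sum>j=1..d. a j * real (t ^ j mod p)) = b"
  shows False
proof -
  have fin: "finite T" using assms(2) finite_subset by blast
  have p1: "1 mod p = 1" using prime_gt_1_nat[OF assms(1)] by simp
  define V where "V = (\<lambda>t j. int (t ^ j mod p)) ` T"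
  have finV: "finite V" using fin by (simp add: V_def)
  \<comment> \<open>Entry 0 of each vector is t^0 mod p = 1, so it carries the constant term of the
    hyperplane equation.\<close>
  have "(\<Sum>j<Suc d. (if j = 0 then - b else a j) * of_int (v j)) = 0" if "v \<in> V" for v
  proof -
    obtain t where t: "t \<in> T" "v = (\<lambda>j. int (t ^ j mod p))" using \<open>v \<in> V\<close> by (auto simp: V_def)
    have "{..<Suc d} = insert 0 {1..d}" by auto
    then show ?thesis using assms(6)[OF t(1)] p1 by (simp add: t(2))
  qed
  then obtain k j1 where k: "j1 < Suc d" "\<not> int p dvd k j1"
    "\<And>v. v \<in> V \<Longrightarrow> (\<Sum>j<Suc d. k j * v j) = 0"
    using primitive_integer_relation_of_real_relation[of V j0 "Suc d" "\<lambda>j. if j = 0 then - b else a j" "int p"]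
      assms(1,4,5) finV by (simp del: sum.lessThan_Suc) blast
  define f where "f = (\<Sum>j\<le>d. monom (k j) j)"
  have coeff_f: "coeff f i = (if i \<le> d then k i else 0)" for i
    by (simp add: f_def coeff_sum)
  have "[:int p:] dvd f"
  proof (rule prime_dvd_poly_if_many_roots[of "int ` T"])
    have "degree f \<le> d" by (rule degree_le) (simp add: coeff_f)
    then show "degree f < card (int ` T)" using assms(3) by (simp add: card_image)
    fix r assume "r \<in> int ` T"
    then obtain t where t: "t \<in> T" "r = int t" by auto
    then have "(\<Sum>j\<le>d. k j * int (t ^ j mod p)) = 0"
      using k(3)[of "\<lambda>j. int (t ^ j mod p)"] by (auto simp: V_def lessThan_Suc_atMost)
    then show "int p dvd poly f r"
      using dvd_poly_sum_monom_diff[of p k d t] by (simp add: f_def t(2))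
  qed (use fin assms(1,2) not_dvd_diff_int_image in auto)
  then have "int p dvd coeff f j1" by (simp only: const_poly_dvd_iff)
  then show False using k by (simp add: coeff_f)
qed

text \<open>Expanding the squares makes the sphere equation a linear relation between 1, the
  coordinates and the squared norm. The bounds on the sum of T keep p from dividing it, as Vieta
  would require.\<close>

lemma moment_curve_mod_sphere:
  fixes c :: "nat \<Rightarrow> real"
  assumes "prime p" "T \<subseteq> {..<p}" "card T = 2 * d" "d \<ge> 2" "0 < \<Sum>T" "\<Sum>T < p"
    and "\<And>t. t \<in> T \<Longrightarrow> (\<Sum>j=1..d. (real (t ^ j mod p) - c j)\<^sup>2) = s"
  shows False
proof -
  have fin: "finite T" using assms(2) finite_subset by blast
  have p1: "1 mod p = 1" using prime_gt_1_nat[OF assms(1)] by simp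
  \<comment> \<open>Entry 0 is the constant 1, entries 1 to d are the coordinates, and entry
    \<open>Suc d\<close> is the squared norm, whose coefficient 1 in \<open>u\<close> makes the
    relation nontrivial.\<close>
  define w where "w t j = (if j \<le> d then int (t ^ j mod p) else (\<Sum>i=1..d. (int (t ^ i mod p))\<^sup>2))" for t j
  define u where "u j = (if j = 0 then (\<Sum>i=1..d. (c i)\<^sup>2) - s else if j \<le> d then - 2 * c j else 1)" for j
  define V where "V = w ` T"
  have finV: "finite V" using fin by (simp add: V_def)
  have sum_split: "(\<Sum>j<Suc (Suc d). g j) = (\<Sum>j\<le>d. g j) + g (Suc d)" for g :: "nat \<Rightarrow> 'a :: comm_monoid_add"
    by (simp add: lessThan_Suc_atMost)
  have "(\<Sum>j<Suc (Suc d). u j * of_int (v j)) = 0" if "v \<in> V" for v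
  proof -
    obtain t where t: "t \<in> T" "v = w t" using \<open>v \<in> V\<close> by (auto simp: V_def)
    have "(\<Sum>j=1..d. (real (t ^ j mod p))\<^sup>2 + (c j)\<^sup>2 - 2 * c j * real (t ^ j mod p)) = s"
      using assms(7)[OF t(1)] by (simp add: power2_diff mult_ac)
    then have "(\<Sum>j=1..d. (real (t ^ j mod p))\<^sup>2) + (\<Sum>j=1..d. (c j)\<^sup>2)
        - (\<Sum>j=1..d. 2 * c j * real (t ^ j mod p)) = s"
      by (simp add: sum.distrib sum_subtractf)
    moreover have "(\<Sum>j\<le>d. u j * of_int (w t j)) =
        (\<Sum>i=1..d. (c i)\<^sup>2) - s - (\<Sum>j=1..d. 2 * c j * real (t ^ j mod p))"
    proof -
      have "{..d} = insert 0 {1..d}" by auto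
      then show ?thesis using p1 by (simp add: u_def w_def sum_negf[symmetric])
    qed
    moreover have "u (Suc d) * of_int (w t (Suc d)) = (\<Sum>j=1..d. (real (t ^ j mod p))\<^sup>2)"
      by (simp add: u_def w_def)
    ultimately show ?thesis by (simp only: sum_split t(2))
  qed
  then obtain k j1 where k: "j1 < Suc (Suc d)" "\<not> int p dvd k j1"
    "\<And>v. v \<in> V \<Longrightarrow> (\<Sum>j<Suc (Suc d). k j * v j) = 0"
    using primitive_integer_relation_of_real_relation[of V "Suc d" "Suc (Suc d)" u "int p"]
      assms(1) finV by (simp add: u_def del: sum.lessThan_Suc) blast
  define f where "f = (\<Sum>j\<le>d. monom (k j) j) + smult (k (Suc d)) (\<Sum>i=1..d. monom 1 (2 * i))"
  have coeff_f: "coeff f i = (if i \<le> d then k i else 0) +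
      k (Suc d) * (\<Sum>j=1..d. if 2 * j = i then 1 else 0)" for i
    by (simp add: f_def coeff_sum)
  have top: "coeff f (2 * d) = k (Suc d)"
    using assms(4) by (simp add: coeff_f)
  have "[:int p:] dvd f"
  proof (rule prime_dvd_poly_if_sum_roots[of "int ` T" _ "2 * d - 1"])
    show "card (int ` T) = Suc (2 * d - 1)" using assms(3,4) by (simp add: card_image)
    show "degree f \<le> Suc (2 * d - 1)"
      by (rule degree_le) (use assms(4) in \<open>auto simp: coeff_f intro!: sum.neutral\<close>)
    \<comment> \<open>The squared norm contributes only even powers, and 2d - 1 > d because d \<ge>
      2, so neither summand of f reaches this degree.\<close>
    have "odd (2 * d - 1)" using assms(4) by simp
    then have "2 * j \<noteq> 2 * d - 1" for j by (metis dvd_triv_left)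
    then show "coeff f (2 * d - 1) = 0" using assms(4) by (simp add: coeff_f)
    have "\<Sum>(int ` T) = int (\<Sum>T)" by (simp add: sum.reindex)
    moreover have "\<not> p dvd \<Sum>T" using assms(5,6) by (auto dest: dvd_imp_le)
    ultimately show "\<not> int p dvd \<Sum>(int ` T)" by (simp only: int_dvd_int_iff not_False_eq_True)
    fix r assume "r \<in> int ` T"
    then obtain t where t: "t \<in> T" "r = int t" by auto
    have sq: "int p dvd (int t ^ i)\<^sup>2 - (int (t ^ i mod p))\<^sup>2" for i
    proof -
      have "int p dvd int t ^ i - int (t ^ i mod p)" by (simp add: zmod_int dvd_minus_mod)
      then show ?thesis by (simp add: power2_eq_square square_diff_square_factored)
    qed
    define E where "E = (\<Sum>i=1..d. (int (t ^ i mod p))\<^sup>2)"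
    have poly_E: "int p dvd (\<Sum>i=1..d. (int t ^ i)\<^sup>2) - E"
      unfolding E_def sum_subtractf[symmetric] by (intro dvd_sum sq)
    have "(\<Sum>j\<le>d. k j * int (t ^ j mod p)) + k (Suc d) * E = 0"
      using k(3)[of "w t"] t(1) unfolding V_def sum_split by (simp add: w_def E_def)
    moreover have "int p dvd poly (\<Sum>j\<le>d. monom (k j) j) (int t) - (\<Sum>j\<le>d. k j * int (t ^ j mod p))"
      by (rule dvd_poly_sum_monom_diff)
    moreover have "poly f r = poly (\<Sum>j\<le>d. monom (k j) j) (int t) + k (Suc d) * (\<Sum>i=1..d. (int t ^ i)\<^sup>2)"
      by (simp add: f_def t(2) poly_sum poly_monom power_mult[symmetric] mult.commute)
    ultimately have "poly f r = (poly (\<Sum>j\<le>d. monom (k j) j) (int t) - (\<Sum>j\<le>d. k j * int (t ^ j mod p)))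
        + k (Suc d) * ((\<Sum>i=1..d. (int t ^ i)\<^sup>2) - E)"
      by (simp add: right_diff_distrib)
    then show "int p dvd poly f r"
      by (simp only:) (intro dvd_add dvd_mult poly_E dvd_poly_sum_monom_diff)
  qed (use fin assms(1,2) not_dvd_diff_int_image in auto)
  then have dvd: "int p dvd coeff f i" for i by (simp only: const_poly_dvd_iff)
  then have lead: "int p dvd k (Suc d)" by (metis top)
  \<comment> \<open>In degrees up to d, the even powers from the squared norm add to
    \<open>k j1\<close> only a multiple of \<open>k (Suc d)\<close>, already divisible by p.\<close>
  have "int p dvd k j1" if "j1 \<le> d"
  proof -
    have "int p dvd k j1 + k (Suc d) * (\<Sum>j=1..d. if 2 * j = j1 then 1 else 0)"
      using dvd[of j1] that by (simp add: coeff_f)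
    then show ?thesis using lead by (metis dvd_add_left_iff dvd_mult2)
  qed
  then show False using k(1,2) lead by (metis less_Suc_eq_le le_Suc_eq)
qed

section \<open>The point set in the grid\<close>

lemma subset_image_inj_cardE:
  assumes "inj_on f A" "P \<subseteq> f ` A"
  obtains B where "B \<subseteq> A" "P = f ` B" "card B = card P"
  using assms by (metis subset_image_inj card_image)

theorem theorem4p1:
  assumes "CARD('d) \<ge> 2"
  shows "\<exists>c::real. c > 0 \<and>
    (\<forall>n::nat. n \<ge> 1 \<longrightarrow>
      (\<exists>A :: (real ^ 'd) set. A \<subseteq> grid n \<and> real (card A) \<ge> c * real n \<and>
        (\<forall>P \<subseteq> A. card P = CARD('d) + 1 \<longrightarrow> \<not> (\<exists>H. is_hyperplane H \<and> P \<subseteq> H)) \<and>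
        (\<forall>P \<subseteq> A. card P = 2 * CARD('d) \<longrightarrow> \<not> (\<exists>S. is_sphere S \<and> P \<subseteq> S))))"
proof -
  \<comment> \<open>The index type is numbered 1, ..., d by \<open>h\<close> with inverse
    \<open>e\<close>; coordinate i will hold the power with exponent \<open>e i\<close>.\<close>
  let ?d = "CARD('d)"
  obtain h :: "nat \<Rightarrow> 'd" where h: "bij_betw h {1..?d} UNIV"
    using ex_bij_betw_nat_finite_1[of "UNIV :: 'd set"] by auto
  define e where "e = inv_into {1..?d} h"
  have e: "e i \<in> {1..?d}" "h (e i) = i" for i
    using h unfolding e_def
    by (metis UNIV_I bij_betw_imp_surj_on inv_into_into, metis UNIV_I bij_betw_imp_surj_on f_inv_into_f)
  have eh: "e (h j) = j" if "j \<in> {1..?d}" for j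
    using h that unfolding e_def by (simp add: bij_betw_def)
  have sum_h: "(\<Sum>i\<in>UNIV. g i) = (\<Sum>j=1..?d. g (h j))" for g :: "'d \<Rightarrow> real"
    using sum.reindex_bij_betw[OF h, of g] by simp
  \<comment> \<open>Small enough that one point suffices for n < 256d. For larger n, n \<le> 64d(|T|
    + 1) and 64d \<le> n/4 give n \<le> 256d|T|.\<close>
  define c :: real where "c = 1 / (256 * ?d)"
  have c0: "c > 0" by (simp add: c_def)
  have "\<exists>A :: (real ^ 'd) set. A \<subseteq> grid n \<and> real (card A) \<ge> c * real n \<and>
        (\<forall>P \<subseteq> A. card P = ?d + 1 \<longrightarrow> \<not> (\<exists>H. is_hyperplane H \<and> P \<subseteq> H)) \<and>
        (\<forall>P \<subseteq> A. card P = 2 * ?d \<longrightarrow> \<not> (\<exists>S. is_sphere S \<and> P \<subseteq> S))"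
    if n: "n \<ge> 1" for n
  proof (cases "n < 256 * ?d")
    case True
    let ?A = "{\<chi> i. 1} :: (real ^ 'd) set"
    have "?A \<subseteq> grid n" using n by (auto simp: grid_def intro!: exI[of _ 1])
    moreover have "real (card ?A) \<ge> c * real n" using True by (simp add: c_def divide_simps)
    moreover have "card P \<noteq> ?d + 1 \<and> card P \<noteq> 2 * ?d" if "P \<subseteq> ?A" for P
      using card_mono[OF _ that] assms by simp
    ultimately show ?thesis by (intro exI[of _ ?A]) blast
  next
    case False
    then have n256: "n \<ge> 256 * ?d" by simp
    then have "n \<ge> 256" using assms by linarith
    then obtain p where p: "prime p" "n < 32 * p" "p \<le> n"
      using exists_prime_within_factor_32[of n] by auto
    \<comment> \<open>Starting at 1 keeps all residues nonzero, as the grid demands; the upper end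
      makes any 2d distinct parameters sum to less than p.\<close>
    define T where "T = {1..(p - 1) div (2 * ?d)}"
    have T_le: "2 * ?d * t \<le> p - 1" if "t \<in> T" for t
    proof -
      have "t \<le> (p - 1) div (2 * ?d)" using that by (simp add: T_def)
      then have "2 * ?d * t \<le> 2 * ?d * ((p - 1) div (2 * ?d))" by simp
      also have "\<dots> \<le> p - 1" by simp
      finally show ?thesis .
    qed
    have p0: "p > 1" using p(1) by (rule prime_gt_1_nat)
    have T_less: "0 < t" "t < p" if "t \<in> T" for t
    proof -
      show "0 < t" using that by (simp add: T_def)
      have "t \<le> 2 * ?d * t" using assms by simp
      then show "t < p" using T_le[OF that] p0 by linarith
    qed
    define v :: "nat \<Rightarrow> real ^ 'd" where "v t = (\<chi> i. real (t ^ e i mod p))" for t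
    have vh: "v t $ h j = real (t ^ j mod p)" if "j \<in> {1..?d}" for t j
      using that by (simp add: v_def eh)
    have inj: "inj_on v T"
    proof (rule inj_onI)
      fix s t assume st: "s \<in> T" "t \<in> T" "v s = v t"
      \<comment> \<open>The coordinate with exponent 1 is t itself, since t < p.\<close>
      then have "v s $ h 1 = v t $ h 1" by simp
      then have "s mod p = t mod p" using vh[of 1] assms by simp
      then show "s = t" using T_less st by simp
    qed
    have "v ` T \<subseteq> grid n"
    proof
      fix x assume "x \<in> v ` T"
      then obtain t where t: "t \<in> T" "x = v t" by auto
      have "t ^ e i mod p \<in> {1..n}" for i
      proof -
        have "\<not> p dvd t" using T_less[OF t(1)] by (auto dest: dvd_imp_le)
        then have "\<not> p dvd t ^ e i" using p(1) prime_dvd_power by blast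
        moreover have "t ^ e i mod p < p" using p0 by simp
        ultimately show ?thesis using p(3) by (auto simp: dvd_eq_mod_eq_0)
      qed
      then show "x \<in> grid n" by (auto simp: grid_def t(2) v_def)
    qed
    moreover have "real (card (v ` T)) \<ge> c * real n"
    proof -
      have "p - 1 < 2 * ?d * Suc ((p - 1) div (2 * ?d))"
        using dividend_less_times_div[of "2 * ?d" "p - 1"] by simp
      then have "p \<le> 2 * ?d * Suc (card T)" using p0 by (simp add: T_def)
      then have "n \<le> 64 * ?d * Suc (card T)" using p(2) by linarith
      then have "real n \<le> real (64 * ?d * Suc (card T))" by (simp only: of_nat_le_iff)
      moreover have "real (256 * ?d) \<le> real n" using n256 by (simp only: of_nat_le_iff)
      ultimately have "real n \<le> 256 * ?d * real (card T)" by (simp add: algebra_simps)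
      then show ?thesis using inj by (simp add: card_image c_def divide_simps mult_ac)
    qed
    moreover have "\<not> (\<exists>H. is_hyperplane H \<and> P \<subseteq> H)" if P: "P \<subseteq> v ` T" "card P = ?d + 1" for P
    proof
      assume "\<exists>H. is_hyperplane H \<and> P \<subseteq> H"
      then obtain a b where ab: "a \<noteq> 0" "\<And>x. x \<in> P \<Longrightarrow> a \<bullet> x = b"
        unfolding is_hyperplane_def by blast
      obtain U where U: "U \<subseteq> T" "P = v ` U" "card U = card P"
        using subset_image_inj_cardE[OF inj P(1)] .
      obtain i where i: "a $ i \<noteq> 0" using ab(1) by (auto simp: vec_eq_iff)
      show False
      proof (rule moment_curve_mod_hyperplane[where a = "\<lambda>j. a $ h j" and T = U])
        fix t assume "t \<in> U"
        then have "a \<bullet> v t = b" using ab(2) U(2) by blast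
        then show "(\<Sum>j=1..?d. a $ h j * real (t ^ j mod p)) = b"
          by (simp add: inner_vec_def sum_h vh)
      qed (use p(1) U P(2) T_less e[of i] i in auto)
    qed
    moreover have "\<not> (\<exists>S. is_sphere S \<and> P \<subseteq> S)" if P: "P \<subseteq> v ` T" "card P = 2 * ?d" for P
    proof
      assume "\<exists>S. is_sphere S \<and> P \<subseteq> S"
      then obtain z r where "P \<subseteq> sphere z r" unfolding is_sphere_def by blast
      then have zr: "dist z x = r" if "x \<in> P" for x using that by auto
      obtain U where U: "U \<subseteq> T" "P = v ` U" "card U = card P"
        using subset_image_inj_cardE[OF inj P(1)] .
      have finU: "finite U" using U(1) by (rule finite_subset) (simp add: T_def)
      \<comment> \<open>Each of the 2d parameters is at most (p - 1)/(2d); multiplying by 2d avoids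
        the division.\<close>
      have "2 * ?d * \<Sum>U = (\<Sum>t\<in>U. 2 * ?d * t)" by (rule sum_distrib_left)
      also have "\<dots> \<le> (\<Sum>t\<in>U. p - 1)" using T_le U(1) by (intro sum_mono) blast
      also have "\<dots> = 2 * ?d * (p - 1)" using U(3) P(2) by simp
      finally have "\<Sum>U \<le> p - 1" by simp
      then have sum_less: "\<Sum>U < p" using p0 by linarith
      have "U \<noteq> {}" using U(3) P(2) assms by auto
      then have sum_pos: "0 < \<Sum>U" using finU U(1) T_less by (intro sum_pos) auto
      show False
      proof (rule moment_curve_mod_sphere[where c = "\<lambda>j. z $ h j" and s = "r\<^sup>2" and T = U])
        fix t assume "t \<in> U"
        then have "dist (v t) z = r" using zr U(2) by (metis dist_commute imageI)
        then have "(v t - z) \<bullet> (v t - z) = r\<^sup>2" by (metis dist_norm power2_norm_eq_inner)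
        then show "(\<Sum>j=1..?d. (real (t ^ j mod p) - z $ h j)\<^sup>2) = r\<^sup>2"
          by (simp add: inner_vec_def sum_h vh power2_eq_square)
      qed (use p(1) U P(2) T_less assms sum_less sum_pos in auto)
    qed
    ultimately show ?thesis by (intro exI[of _ "v ` T"]) blast
  qed
  then show ?thesis using c0 by (intro exI[of _ c]) blast
qed

end
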